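(* $\pi_{C_5}(K_3)\le \frac{24}{625}$. Equivalently, $$\lim_{n\to\infty}\frac{\mathrm{ex}_{C_5}(n,\{K_3\})}{\binom{n}{5}}\le \frac{24}{625}.$$
   Context: All graphs are simple. For a graph $G$ on $n$ vertices and a graph $A$ on $k$ vertices, let $C_A(G)$ be the set of $k$-element subsets of $V(G)$ that induce a copy of $A$ in $G$. The $A$-density of $G$ is $d_A(G)=|C_A(G)|/\binom{n}{k}$. For a family $\mathcal{F}$ of forbidden graphs, set $$\mathrm{ex}_A(n,\mathcal{F})=\max\{|C_A(G)| : G \text{ is } \mathcal{F}\text{-free},\ |V(G)|=n\},$$ where $\mathcal{F}$-free means containing no member of $\mathcal{F}$ as a subgraph. The Turán density is $\pi_A(\mathcal{F})=\lim_{n\to\infty}\mathrm{ex}_A(n,\mathcal{F})/\binom{n}{k}$; this limit exists. Here $A=C_5$ is the 5-cycle and $\mathcal{F}=\{K_3\}$. So $\pi_{C_5}(K_3)$ is the limit, as $n\to\infty$, of the maximum over triangle-free $n$-vertex graphs $G$ of the number of 5-vertex subsets inducing a $5$-cycle, divided by $\binom{n}{5}$. *)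

theory Defs
  imports Complex_Main
begin

definition graphs_on :: "nat \<Rightarrow> nat set set set" where
  "graphs_on n = Pow {e. e \<subseteq> {0..<n} \<and> card e = 2}"

definition triangle_free :: "nat set set \<Rightarrow> bool" where
  "triangle_free E \<longleftrightarrow>
     \<not> (\<exists>a b c. a \<noteq> b \<and> b \<noteq> c \<and> a \<noteq> c \<and>
            {a, b} \<in> E \<and> {b, c} \<in> E \<and> {a, c} \<in> E)"

definition c5_adj :: "nat \<Rightarrow> nat \<Rightarrow> bool" where
  "c5_adj i j \<longleftrightarrow> j = (i + 1) mod 5 \<or> i = (j + 1) mod 5"

definition induces_C5 :: "nat set set \<Rightarrow> nat set \<Rightarrow> bool" where
  "induces_C5 E S \<longleftrightarrow>
     (\<exists>f. bij_betw f {0..<5::nat} S \<and>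
          (\<forall>i<5. \<forall>j<5. ({f i, f j} \<in> E \<longleftrightarrow> c5_adj i j)))"

definition C5_copies :: "nat \<Rightarrow> nat set set \<Rightarrow> nat set set" where
  "C5_copies n E = {S. S \<subseteq> {0..<n} \<and> card S = 5 \<and> induces_C5 E S}"

definition ex_C5_K3 :: "nat \<Rightarrow> nat" where
  "ex_C5_K3 n = Max {card (C5_copies n E) | E. E \<in> graphs_on n \<and> triangle_free E}"

end

theory Submission
  imports Defs "HOL-Real_Asymp.Real_Asymp" "HOL-Library.FuncSet"
begin

text \<open>
  The upper bound is a flag-algebra argument. Closed walks of length 5 in a triangle-free graph
  with vertex set V are counted by summing over all maps from five positions into V, repetitions
  allowed. Fix the images i, j, k of three positions. For every function v of the adjacencies
  between a further vertex and i, j, k, the sum of v(l) v(m) over all l and m is a perfect square,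
  so adding a positive multiple of it to the walk count can only increase the total. With
  suitable squares, depending on the graph induced on i, j, k, the average over the orderings of
  the five positions of 1250 [the five vertices form a pentagon] plus all squares is at most 48 for
  each triangle-free graph on five vertices, so the pentagon density is at most 48/1250 = 24/625.
  Since repetitions are allowed, there is no error term: a triangle-free graph on n vertices has at
  most (n/5)^5 pentagons. Balanced blow-ups of the pentagon attain this asymptotically, so the
  limit exists (and equals 24/625).
\<close>

section \<open>Sums over 5-tuples of vertices\<close>

text \<open>Read as a map from \<open>pos\<close>, a 5-tuple has its entries permuted by
  precomposition, and a graph pulls back along it to a relation on five points.\<close>

datatype pos = P1 | P2 | P3 | P4 | P5

lemma UNIV_pos: "(UNIV :: pos set) = {P1, P2, P3, P4, P5}"
  by (auto intro: pos.exhaust)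

instance pos :: finite
  by standard (simp add: UNIV_pos)

abbreviation tuples :: "'a set \<Rightarrow> ('a \<times> 'a \<times> 'a \<times> 'a \<times> 'a) set" where
  "tuples V \<equiv> V \<times> V \<times> V \<times> V \<times> V"

lemma sum_tuples_eq_sum_Pi:
  "(\<Sum>(u, v, w, x, y)\<in>tuples V. F u v w x y) =
   (\<Sum>x\<in>UNIV \<rightarrow> V. F (x P1) (x P2) (x P3) (x P4) (x P5))"
  by (rule sum.reindex_bij_witness[where i = "\<lambda>x. (x P1, x P2, x P3, x P4, x P5)"
        and j = "\<lambda>(u, v, w, x, y). case_pos u v w x y"])
     (auto simp: Pi_iff fun_eq_iff split: pos.splits)

lemma sum_tuples_permute:
  fixes i j k l m :: pos
  assumes "distinct [i, j, k, l, m]"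
  shows "(\<Sum>x\<in>UNIV \<rightarrow> V. F (x i) (x j) (x k) (x l) (x m)) =
         (\<Sum>(u, v, w, x, y)\<in>tuples V. F u v w x y)"
proof -
  let ?\<pi> = "case_pos i j k l m"
  have "inj ?\<pi>"
    using assms by (auto simp: inj_def split: pos.splits)
  then have bij: "bij ?\<pi>"
    by (simp add: bij_def finite_UNIV_inj_surj)
  have "(\<Sum>x\<in>UNIV \<rightarrow> V. F (x (?\<pi> P1)) (x (?\<pi> P2)) (x (?\<pi> P3)) (x (?\<pi> P4)) (x (?\<pi> P5))) =
        (\<Sum>x\<in>UNIV \<rightarrow> V. F (x P1) (x P2) (x P3) (x P4) (x P5))"
    by (rule sum.reindex_bij_witness[where i = "\<lambda>x. x \<circ> inv ?\<pi>" and j = "\<lambda>x. x \<circ> ?\<pi>"])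
       (use bij in \<open>auto simp: fun_eq_iff Pi_iff bij_is_surj surj_f_inv_f bij_is_inj\<close>)
  then show ?thesis
    by (simp add: sum_tuples_eq_sum_Pi)
qed

lemma sum_sum_list_swap:
  fixes f :: "'a \<Rightarrow> 'b \<Rightarrow> 'c :: comm_monoid_add"
  shows "(\<Sum>x\<in>A. \<Sum>y\<leftarrow>ys. f x y) = (\<Sum>y\<leftarrow>ys. \<Sum>x\<in>A. f x y)"
  by (induction ys) (auto simp: sum.distrib)

text \<open>Every reordering of the positions permutes the maps into \<open>V\<close>, so each entry
  of \<open>ps\<close> yields the same total. An inequality for the sum over orderings, proved map
  by map, thus becomes one between totals.\<close>

lemma sum_tuples_permute_list:
  fixes F :: "'a \<Rightarrow> 'a \<Rightarrow> 'a \<Rightarrow> 'a \<Rightarrow> 'a \<Rightarrow> int"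
    and ps :: "(pos \<times> pos \<times> pos \<times> pos \<times> pos) list"
  assumes "\<forall>(i, j, k, l, m)\<in>set ps. distinct [i, j, k, l, m]"
  shows "(\<Sum>x\<in>UNIV \<rightarrow> V. \<Sum>(i, j, k, l, m)\<leftarrow>ps. F (x i) (x j) (x k) (x l) (x m)) =
         int (length ps) * (\<Sum>(u, v, w, x, y)\<in>tuples V. F u v w x y)"
proof -
  have "(\<Sum>x\<in>UNIV \<rightarrow> V. case p of (i, j, k, l, m) \<Rightarrow> F (x i) (x j) (x k) (x l) (x m)) =
        (\<Sum>(u, v, w, x, y)\<in>tuples V. F u v w x y)" if "p \<in> set ps" for p
  proof -
    obtain i j k l m where p: "p = (i, j, k, l, m)"
      by (cases p) auto
    with assms that have "distinct [i, j, k, l, m]"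
      by auto
    from sum_tuples_permute[OF this, of F V] show ?thesis
      by (simp add: p)
  qed
  then have "(\<Sum>p\<leftarrow>ps. \<Sum>x\<in>UNIV \<rightarrow> V. case p of (i, j, k, l, m) \<Rightarrow> F (x i) (x j) (x k) (x l) (x m)) =
      (\<Sum>p\<leftarrow>ps. \<Sum>(u, v, w, x, y)\<in>tuples V. F u v w x y)"
    by (intro arg_cong[of _ _ sum_list] map_cong refl) auto
  then show ?thesis
    by (subst sum_sum_list_swap) (simp add: sum_list_triv)
qed

section \<open>The sum-of-squares certificate\<close>

text \<open>
  Weights c and functions v of the adjacencies p, q, r of a further vertex to i, j, k. A triple
  with one edge is used only when k is isolated, and one with two edges only when k is the centre;
  reordering brings every triple into this form. Since the bound is tight for balanced blow-ups of
  the pentagon, every v has to sum to 0 over the vertices of such a blow-up, for all i, j, k in it.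
  This leaves a small semidefinite feasibility problem, of which the weights are an integral
  solution.
\<close>

definition squares :: "bool \<Rightarrow> bool \<Rightarrow> bool \<Rightarrow> (int \<times> (int \<Rightarrow> int \<Rightarrow> int \<Rightarrow> int)) list" where
  "squares ij ik jk =
    (if ij then (if ik \<or> jk then [] else
       [(6, \<lambda>p q r. 12 - 23 * (p + q) - 21 * r + 37 * (p + q) * r),
        (27, \<lambda>p q r. (p + q) * (1 - 2 * r)),
        (423, \<lambda>p q r. p - q),
        (4500, \<lambda>p q r. (p - q) * r)])
     else if ik \<and> jk then
       [(384, \<lambda>p q r. p + q + 3 * r - 2),
        (93, \<lambda>p q r. 3 * (p + q) + 4 * r - 4),
        (2943, \<lambda>p q r. p - q)]
     else if ik \<or> jk then []
     else
       [(12, \<lambda>p q r. if p + q + r = 0 \<or> p + q + r = 2 then 2 else - 3),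
        (200, \<lambda>p q r. if p + q + r = 1 then 1 else if p + q + r = 2 then - 1 else 0),
        (402, \<lambda>p q r. p - q)])"

definition flag_value ::
    "('a \<Rightarrow> 'a \<Rightarrow> bool) \<Rightarrow> 'a \<Rightarrow> 'a \<Rightarrow> 'a \<Rightarrow> (int \<Rightarrow> int \<Rightarrow> int \<Rightarrow> int) \<Rightarrow> 'a \<Rightarrow> int" where
  "flag_value r i j k v l = v (of_bool (r i l)) (of_bool (r j l)) (of_bool (r k l))"

definition squares_term ::
    "('a \<Rightarrow> 'a \<Rightarrow> bool) \<Rightarrow> 'a \<Rightarrow> 'a \<Rightarrow> 'a \<Rightarrow> 'a \<Rightarrow> 'a \<Rightarrow> int" where
  "squares_term r i j k l m = (\<Sum>(c, v)\<leftarrow>squares (r i j) (r i k) (r j k).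
      c * flag_value r i j k v l * flag_value r i j k v m)"

definition cycle5 :: "('a \<Rightarrow> 'a \<Rightarrow> bool) \<Rightarrow> 'a \<Rightarrow> 'a \<Rightarrow> 'a \<Rightarrow> 'a \<Rightarrow> 'a \<Rightarrow> bool" where
  "cycle5 r i j k l m \<longleftrightarrow> r i j \<and> r j k \<and> r k l \<and> r l m \<and> r m i"

text \<open>For each pair in \<open>cs\<close> the double sum factors as \<open>c\<close> times the
  square of the sum of \<open>g v\<close> over \<open>V\<close>. Terms with l = m are included, so
  the square is exact.\<close>

lemma sum_weighted_squares_nonneg:
  fixes g :: "'b \<Rightarrow> 'a \<Rightarrow> int"
  assumes "\<forall>(c, v)\<in>set cs. c \<ge> 0"
  shows "0 \<le> (\<Sum>l\<in>V. \<Sum>m\<in>V. \<Sum>(c, v)\<leftarrow>cs. c * g v l * g v m)"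
  using assms
proof (induction cs)
  case (Cons cv cs)
  obtain c v where cv: "cv = (c, v)"
    by (cases cv)
  have "(\<Sum>l\<in>V. \<Sum>m\<in>V. c * g v l * g v m) = c * (\<Sum>l\<in>V. g v l)\<^sup>2"
    unfolding power2_eq_square sum_product by (simp add: sum_distrib_left mult.assoc)
  also have "\<dots> \<ge> 0"
    using Cons.prems by (simp add: cv)
  finally show ?case
    using Cons by (simp add: cv sum.distrib)
qed simp

lemma sum_squares_term_nonneg:
  "0 \<le> (\<Sum>(i, j, k, l, m)\<in>tuples V. squares_term r i j k l m)"
proof -
  have "\<forall>(c, v)\<in>set (squares ij ik jk). c \<ge> 0" for ij ik jk
    by (simp add: squares_def)
  then have "0 \<le> (\<Sum>i\<in>V. \<Sum>j\<in>V. \<Sum>k\<in>V. \<Sum>l\<in>V. \<Sum>m\<in>V. squares_term r i j k l m)"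
    unfolding squares_term_def by (intro sum_nonneg sum_weighted_squares_nonneg)
  then show ?thesis
    by (simp add: sum.cartesian_product)
qed

text \<open>
  All 120 orderings could be used; one per orbit suffices, as \<^const>\<open>squares_term\<close> is invariant
  under swapping i, j and swapping l, m, and \<^const>\<open>cycle5\<close> under the dihedral group (for
  symmetric relations).
\<close>

definition flag_orders :: "(pos \<times> pos \<times> pos \<times> pos \<times> pos) list" where
  "flag_orders =
    [(P4, P5, P3, P1, P2), (P3, P5, P4, P1, P2), (P3, P4, P5, P1, P2),
     (P4, P5, P2, P1, P3), (P2, P5, P4, P1, P3), (P2, P4, P5, P1, P3),
     (P3, P5, P2, P1, P4), (P2, P5, P3, P1, P4), (P2, P3, P5, P1, P4),
     (P3, P4, P2, P1, P5), (P2, P4, P3, P1, P5), (P2, P3, P4, P1, P5),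
     (P4, P5, P1, P2, P3), (P1, P5, P4, P2, P3), (P1, P4, P5, P2, P3),
     (P3, P5, P1, P2, P4), (P1, P5, P3, P2, P4), (P1, P3, P5, P2, P4),
     (P3, P4, P1, P2, P5), (P1, P4, P3, P2, P5), (P1, P3, P4, P2, P5),
     (P2, P5, P1, P3, P4), (P1, P5, P2, P3, P4), (P1, P2, P5, P3, P4),
     (P2, P4, P1, P3, P5), (P1, P4, P2, P3, P5), (P1, P2, P4, P3, P5),
     (P2, P3, P1, P4, P5), (P1, P3, P2, P4, P5), (P1, P2, P3, P4, P5)]"

definition cycle_orders :: "(pos \<times> pos \<times> pos \<times> pos \<times> pos) list" where
  "cycle_orders =
    [(P1, P2, P3, P4, P5), (P1, P2, P3, P5, P4), (P1, P2, P4, P3, P5),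
     (P1, P2, P4, P5, P3), (P1, P2, P5, P3, P4), (P1, P2, P5, P4, P3),
     (P1, P3, P2, P4, P5), (P1, P3, P2, P5, P4), (P1, P3, P4, P2, P5),
     (P1, P3, P5, P2, P4), (P1, P4, P2, P3, P5), (P1, P4, P3, P2, P5)]"

definition has_triangle :: "(pos \<Rightarrow> pos \<Rightarrow> bool) \<Rightarrow> bool" where
  "has_triangle r = list_ex (\<lambda>(i, j, k). r i j \<and> r i k \<and> r j k)
    [(P1, P2, P3), (P1, P2, P4), (P1, P2, P5), (P1, P3, P4), (P1, P3, P5), (P1, P4, P5),
     (P2, P3, P4), (P2, P3, P5), (P2, P4, P5), (P3, P4, P5)]"

text \<open>Ten Booleans encode a symmetric irreflexive relation on \<open>pos\<close>, which
  reduces the certificate to 1024 cases settled by evaluation.\<close>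

fun edge_table :: "bool \<Rightarrow> bool \<Rightarrow> bool \<Rightarrow> bool \<Rightarrow> bool \<Rightarrow> bool \<Rightarrow> bool \<Rightarrow> bool \<Rightarrow> bool \<Rightarrow> bool \<Rightarrow>
    pos \<Rightarrow> pos \<Rightarrow> bool" where
  "edge_table e12 e13 e14 e15 e23 e24 e25 e34 e35 e45 P1 P2 = e12"
| "edge_table e12 e13 e14 e15 e23 e24 e25 e34 e35 e45 P2 P1 = e12"
| "edge_table e12 e13 e14 e15 e23 e24 e25 e34 e35 e45 P1 P3 = e13"
| "edge_table e12 e13 e14 e15 e23 e24 e25 e34 e35 e45 P3 P1 = e13"
| "edge_table e12 e13 e14 e15 e23 e24 e25 e34 e35 e45 P1 P4 = e14"
| "edge_table e12 e13 e14 e15 e23 e24 e25 e34 e35 e45 P4 P1 = e14"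
| "edge_table e12 e13 e14 e15 e23 e24 e25 e34 e35 e45 P1 P5 = e15"
| "edge_table e12 e13 e14 e15 e23 e24 e25 e34 e35 e45 P5 P1 = e15"
| "edge_table e12 e13 e14 e15 e23 e24 e25 e34 e35 e45 P2 P3 = e23"
| "edge_table e12 e13 e14 e15 e23 e24 e25 e34 e35 e45 P3 P2 = e23"
| "edge_table e12 e13 e14 e15 e23 e24 e25 e34 e35 e45 P2 P4 = e24"
| "edge_table e12 e13 e14 e15 e23 e24 e25 e34 e35 e45 P4 P2 = e24"
| "edge_table e12 e13 e14 e15 e23 e24 e25 e34 e35 e45 P2 P5 = e25"
| "edge_table e12 e13 e14 e15 e23 e24 e25 e34 e35 e45 P5 P2 = e25"
| "edge_table e12 e13 e14 e15 e23 e24 e25 e34 e35 e45 P3 P4 = e34"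
| "edge_table e12 e13 e14 e15 e23 e24 e25 e34 e35 e45 P4 P3 = e34"
| "edge_table e12 e13 e14 e15 e23 e24 e25 e34 e35 e45 P3 P5 = e35"
| "edge_table e12 e13 e14 e15 e23 e24 e25 e34 e35 e45 P5 P3 = e35"
| "edge_table e12 e13 e14 e15 e23 e24 e25 e34 e35 e45 P4 P5 = e45"
| "edge_table e12 e13 e14 e15 e23 e24 e25 e34 e35 e45 P5 P4 = e45"
| "edge_table e12 e13 e14 e15 e23 e24 e25 e34 e35 e45 P1 P1 = False"
| "edge_table e12 e13 e14 e15 e23 e24 e25 e34 e35 e45 P2 P2 = False"
| "edge_table e12 e13 e14 e15 e23 e24 e25 e34 e35 e45 P3 P3 = False"
| "edge_table e12 e13 e14 e15 e23 e24 e25 e34 e35 e45 P4 P4 = False"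
| "edge_table e12 e13 e14 e15 e23 e24 e25 e34 e35 e45 P5 P5 = False"

text \<open>
  A pentagon is hit by exactly one of the 12 cycle orders, and there are 30 flag orders, whence
  37500 = 30 * 1250 and 1440 = 30 * 48.
\<close>

lemma certificate_edge_table:
  "\<forall>e12 e13 e14 e15 e23 e24 e25 e34 e35 e45.
    has_triangle (edge_table e12 e13 e14 e15 e23 e24 e25 e34 e35 e45) \<or>
    (\<Sum>(i, j, k, l, m)\<leftarrow>flag_orders.
       squares_term (edge_table e12 e13 e14 e15 e23 e24 e25 e34 e35 e45) i j k l m) +
    37500 * (\<Sum>(i, j, k, l, m)\<leftarrow>cycle_orders.
       of_bool (cycle5 (edge_table e12 e13 e14 e15 e23 e24 e25 e34 e35 e45) i j k l m)) \<le> 1440"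
  by code_simp

lemma certificate:
  fixes r :: "pos \<Rightarrow> pos \<Rightarrow> bool"
  assumes sym: "\<And>i j. r i j \<longleftrightarrow> r j i"
    and triangle_free: "\<And>i j k. \<not> (r i j \<and> r j k \<and> r i k)"
  shows "(\<Sum>(i, j, k, l, m)\<leftarrow>flag_orders. squares_term r i j k l m) +
         37500 * (\<Sum>(i, j, k, l, m)\<leftarrow>cycle_orders. of_bool (cycle5 r i j k l m)) \<le> 1440"
proof -
  \<comment> \<open>The triangle hypothesis does not ask for distinct points, so i = j = k gives
    irreflexivity.\<close>
  have "\<not> r i i" for i
    using triangle_free by blast
  then have "r i j = edge_table (r P1 P2) (r P1 P3) (r P1 P4) (r P1 P5) (r P2 P3) (r P2 P4)
      (r P2 P5) (r P3 P4) (r P3 P5) (r P4 P5) i j" for i j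
    using sym by (cases i; cases j) auto
  then have r: "r = edge_table (r P1 P2) (r P1 P3) (r P1 P4) (r P1 P5) (r P2 P3) (r P2 P4)
      (r P2 P5) (r P3 P4) (r P3 P5) (r P4 P5)"
    by (intro ext)
  have "\<not> has_triangle r"
    using triangle_free by (auto simp: has_triangle_def)
  then show ?thesis
    using certificate_edge_table r by metis
qed

section \<open>Bounding the number of pentagons\<close>

lemma card_cycle5_le:
  fixes r :: "'a \<Rightarrow> 'a \<Rightarrow> bool"
  assumes "finite V"
    and sym: "\<And>x y. r x y \<longleftrightarrow> r y x"
    and triangle_free: "\<And>x y z. \<not> (r x y \<and> r y z \<and> r x z)"
  shows "625 * card {(i, j, k, l, m)\<in>tuples V. cycle5 r i j k l m} \<le> 2 * card V ^ 5"
proof -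
  let ?S = "\<Sum>(i, j, k, l, m)\<in>tuples V. squares_term r i j k l m"
  let ?C = "\<Sum>(i, j, k, l, m)\<in>tuples V. of_bool (cycle5 r i j k l m) :: int"
  have fin: "finite (tuples V)"
    using assms by simp
  have "(\<Sum>(i, j, k, l, m)\<leftarrow>flag_orders. squares_term r (x i) (x j) (x k) (x l) (x m)) +
      37500 * (\<Sum>(i, j, k, l, m)\<leftarrow>cycle_orders. of_bool (cycle5 r (x i) (x j) (x k) (x l) (x m))) \<le> 1440"
    for x
    \<comment> \<open>Symmetry and the triangle condition survive pullback along any
      \<open>x\<close>, injective or not, so tuples with repeated vertices are covered.\<close>
    using certificate[of "\<lambda>i j. r (x i) (x j)"] sym triangle_free
    by (simp add: squares_term_def flag_value_def cycle5_def)
  then have "(\<Sum>x\<in>UNIV \<rightarrow> V. (\<Sum>(i, j, k, l, m)\<leftarrow>flag_orders. squares_term r (x i) (x j) (x k) (x l) (x m)) +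
      37500 * (\<Sum>(i, j, k, l, m)\<leftarrow>cycle_orders. of_bool (cycle5 r (x i) (x j) (x k) (x l) (x m)))) \<le>
      (\<Sum>x\<in>(UNIV :: pos set) \<rightarrow> V. 1440)"
    by (intro sum_mono)
  moreover have "(\<Sum>x\<in>UNIV \<rightarrow> V. \<Sum>(i, j, k, l, m)\<leftarrow>flag_orders. squares_term r (x i) (x j) (x k) (x l) (x m)) =
      30 * ?S"
    by (subst sum_tuples_permute_list) (simp_all add: flag_orders_def)
  moreover have "(\<Sum>x\<in>UNIV \<rightarrow> V. \<Sum>(i, j, k, l, m)\<leftarrow>cycle_orders.
      of_bool (cycle5 r (x i) (x j) (x k) (x l) (x m))) = 12 * ?C"
    by (subst sum_tuples_permute_list) (simp_all add: cycle_orders_def)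
  moreover have "(\<Sum>x\<in>(UNIV :: pos set) \<rightarrow> V. 1440 :: int) = 1440 * int (card V) ^ 5"
    by (subst sum_tuples_eq_sum_Pi[symmetric, of "\<lambda>_ _ _ _ _. 1440"])
       (simp add: card_cartesian_product eval_nat_numeral)
  ultimately have "30 * ?S + 37500 * (12 * ?C) \<le> 1440 * int (card V) ^ 5"
    by (simp only: sum.distrib sum_distrib_left[symmetric])
  \<comment> \<open>Dropping the nonnegative \<open>30 * ?S\<close> leaves 450000 times
    \<open>?C\<close> on the left; divide by 720.\<close>
  with sum_squares_term_nonneg[of r V] have "625 * ?C \<le> 2 * int (card V) ^ 5"
    by linarith
  moreover have "?C = int (card {(i, j, k, l, m)\<in>tuples V. cycle5 r i j k l m})"
  proof -
    have "?C = (\<Sum>p\<in>tuples V. of_bool (case p of (i, j, k, l, m) \<Rightarrow> cycle5 r i j k l m))"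
      by (intro sum.cong) auto
    also have "\<dots> = int (card {(i, j, k, l, m)\<in>tuples V. cycle5 r i j k l m})"
      using fin by (simp add: Int_def) (rule arg_cong[of _ _ card], auto)
    finally show ?thesis .
  qed
  ultimately have "int (625 * card {(i, j, k, l, m)\<in>tuples V. cycle5 r i j k l m}) \<le> int (2 * card V ^ 5)"
    by simp
  then show ?thesis
    by (simp only: of_nat_le_iff)
qed

text \<open>The five rotations and five reflections of the pentagon, each listed as the closed walk
  it produces.\<close>

definition dihedral5 :: "nat list list" where
  "dihedral5 =
    [[0, 1, 2, 3, 4], [1, 2, 3, 4, 0], [2, 3, 4, 0, 1], [3, 4, 0, 1, 2], [4, 0, 1, 2, 3],
     [4, 3, 2, 1, 0], [3, 2, 1, 0, 4], [2, 1, 0, 4, 3], [1, 0, 4, 3, 2], [0, 4, 3, 2, 1]]"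

text \<open>Fix one labelling of each pentagon and traverse it by the ten dihedral symmetries. The
  entries of the resulting walk recover the vertex set, hence the labelling, whose injectivity then
  recovers the symmetry.\<close>

lemma card_C5_copies_le_cycle5:
  "10 * card (C5_copies n E) \<le>
    card {(i, j, k, l, m)\<in>tuples {0..<n}. cycle5 (\<lambda>x y. {x, y} \<in> E) i j k l m}"
    (is "_ \<le> card ?Z")
proof -
  define f where "f S = (SOME f. bij_betw f {0..<5::nat} S \<and>
    (\<forall>i<5. \<forall>j<5. ({f i, f j} \<in> E \<longleftrightarrow> c5_adj i j)))" for S
  have f: "bij_betw (f S) {0..<5::nat} S" "\<And>i j. i < 5 \<Longrightarrow> j < 5 \<Longrightarrow> {f S i, f S j} \<in> E \<longleftrightarrow> c5_adj i j"
    if "S \<in> C5_copies n E" for S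
  proof -
    from that have "\<exists>f. bij_betw f {0..<5::nat} S \<and> (\<forall>i<5. \<forall>j<5. ({f i, f j} \<in> E \<longleftrightarrow> c5_adj i j))"
      by (simp add: C5_copies_def induces_C5_def)
    from someI_ex[OF this, folded f_def]
    show "bij_betw (f S) {0..<5::nat} S" "\<And>i j. i < 5 \<Longrightarrow> j < 5 \<Longrightarrow> {f S i, f S j} \<in> E \<longleftrightarrow> c5_adj i j"
      by auto
  qed
  define tup where "tup = (\<lambda>(S, d). (f S (d ! 0), f S (d ! 1), f S (d ! 2), f S (d ! 3), f S (d ! 4)))"
  have set_d: "set d = {0..<5}" and length_d: "length d = 5"
    and adj_d: "cycle5 c5_adj (d ! 0) (d ! 1) (d ! 2) (d ! 3) (d ! 4)" if "d \<in> set dihedral5" for d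
    using that by (auto simp: dihedral5_def cycle5_def c5_adj_def)
  have tup_list: "tup (S, d) = (i, j, k, l, m) \<longleftrightarrow> map (f S) d = [i, j, k, l, m]"
    if "d \<in> set dihedral5" for S d i j k l m
    using that by (auto simp: tup_def dihedral5_def)
  have "inj_on tup (C5_copies n E \<times> set dihedral5)"
  proof (rule inj_onI, clarify)
    fix S d T e
    assume S: "S \<in> C5_copies n E" and d: "d \<in> set dihedral5"
      and T: "T \<in> C5_copies n E" and e: "e \<in> set dihedral5" and eq: "tup (S, d) = tup (T, e)"
    obtain i j k l m where "tup (S, d) = (i, j, k, l, m)"
      by (metis surj_pair)
    with eq have "tup (S, d) = (i, j, k, l, m)" "tup (T, e) = (i, j, k, l, m)"
      by simp_all
    then have maps: "map (f S) d = map (f T) e"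
      by (simp only: tup_list[OF d] tup_list[OF e])
    then have "f S ` set d = f T ` set e"
      by (metis set_map)
    then have "S = T"
      using f(1)[OF S] f(1)[OF T] set_d[OF d] set_d[OF e] by (simp add: bij_betw_def)
    with maps f(1)[OF S] set_d[OF d] set_d[OF e] have "d = e"
      by (auto simp: bij_betw_def dest: map_inj_on)
    with \<open>S = T\<close> show "S = T \<and> d = e"
      by simp
  qed
  moreover have "tup ` (C5_copies n E \<times> set dihedral5) \<subseteq> ?Z"
  proof clarify
    fix S d i j k l m
    assume S: "S \<in> C5_copies n E" and d: "d \<in> set dihedral5" and eq: "(i, j, k, l, m) = tup (S, d)"
    have lt: "d ! t < 5" if "t < 5" for t
      using that set_d[OF d] length_d[OF d] nth_mem[of t d] by auto
    have "f S (d ! t) \<in> {0..<n}" if "t < 5" for t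
      using lt[OF that] bij_betwE[OF f(1)[OF S]] S by (fastforce simp: C5_copies_def)
    then show "(i, j, k, l, m) \<in> tuples {0..<n} \<and> cycle5 (\<lambda>x y. {x, y} \<in> E) i j k l m"
      using eq adj_d[OF d] f(2)[OF S] lt by (simp add: tup_def cycle5_def)
  qed
  moreover have "finite ?Z"
    by (rule finite_subset[of _ "tuples {0..<n}"]) auto
  ultimately have "card (C5_copies n E \<times> set dihedral5) \<le> card ?Z"
    by (rule card_inj_on_le)
  moreover have "card (set dihedral5) = 10"
    by (simp add: dihedral5_def)
  ultimately show ?thesis
    by (simp add: card_cartesian_product mult.commute)
qed

lemma card_C5_copies_le:
  assumes E: "E \<in> graphs_on n" and tf: "triangle_free E"
  shows "3125 * card (C5_copies n E) \<le> n ^ 5"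
proof -
  \<comment> \<open>Edges have two elements, which supplies the distinctness demanded by
    \<open>triangle_free\<close>.\<close>
  have ne: "x \<noteq> y" if "{x, y} \<in> E" for x y
    using that E by (auto simp: graphs_on_def)
  have "625 * card {(i, j, k, l, m)\<in>tuples {0..<n}. cycle5 (\<lambda>x y. {x, y} \<in> E) i j k l m} \<le>
      2 * card {0..<n} ^ 5"
  proof (rule card_cycle5_le)
    show "\<not> ({x, y} \<in> E \<and> {y, z} \<in> E \<and> {x, z} \<in> E)" for x y z
      using tf ne unfolding triangle_free_def by blast
  qed (auto simp: insert_commute)
  with card_C5_copies_le_cycle5[of n E] show ?thesis
    by simp
qed

section \<open>Balanced blow-ups of the pentagon\<close>

definition pentagon_blowup :: "nat \<Rightarrow> nat set set" where
  "pentagon_blowup n = {{x, y} | x y. x < n \<and> y < n \<and> c5_adj (x mod 5) (y mod 5)}"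

lemma c5_adj_sym: "c5_adj i j \<longleftrightarrow> c5_adj j i"
  by (auto simp: c5_adj_def)

lemma less_5_cases: "i < 5 \<Longrightarrow> i = 0 \<or> i = 1 \<or> i = 2 \<or> i = 3 \<or> i = (4::nat)"
  by linarith

text \<open>Equal indices are allowed, so this also rules out loops in the blow-up.\<close>

lemma c5_adj_triangle_free:
  assumes "i < 5" "j < 5" "k < 5"
  shows "\<not> (c5_adj i j \<and> c5_adj j k \<and> c5_adj i k)"
  using assms[THEN less_5_cases] by (elim disjE) (simp_all add: c5_adj_def)

lemma in_pentagon_blowup_iff:
  "{x, y} \<in> pentagon_blowup n \<longleftrightarrow> x < n \<and> y < n \<and> c5_adj (x mod 5) (y mod 5)"
  unfolding pentagon_blowup_def by (auto simp: doubleton_eq_iff c5_adj_sym)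

lemma pentagon_blowup_in_graphs_on: "pentagon_blowup n \<in> graphs_on n"
proof -
  have "x \<noteq> y" if "c5_adj (x mod 5) (y mod 5)" for x y
    using that c5_adj_triangle_free[of "x mod 5" "x mod 5" "x mod 5"] by auto
  then show ?thesis
    by (auto simp: graphs_on_def pentagon_blowup_def)
qed

lemma triangle_free_pentagon_blowup: "triangle_free (pentagon_blowup n)"
  using c5_adj_triangle_free[of "_ mod 5" "_ mod 5" "_ mod 5"]
  by (fastforce simp: triangle_free_def in_pentagon_blowup_iff)

text \<open>One vertex from each residue class modulo 5 induces a pentagon, and each class has at
  least \<open>n div 5\<close> vertices. Residues recover the choice \<open>q\<close> from the
  chosen set.\<close>

lemma card_C5_copies_pentagon_blowup_ge:
  "(n div 5) ^ 5 \<le> card (C5_copies n (pentagon_blowup n))"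
proof -
  let ?Q = "{0..<5::nat} \<rightarrow>\<^sub>E {0..<n div 5}"
  let ?h = "\<lambda>q i. 5 * q i + i :: nat"
  let ?S = "\<lambda>q. ?h q ` {0..<5}"
  have inj: "inj_on (?h q) {0..<5}" for q
    by (rule inj_onI) (metis mod_mult_self4 mod_less atLeastLessThan_iff)
  have "inj_on ?S ?Q"
  proof (rule inj_onI)
    fix q q' assume q: "q \<in> ?Q" and q': "q' \<in> ?Q" and eq: "?S q = ?S q'"
    have "q i = q' i" if "i \<in> {0..<5}" for i
    proof -
      from eq that have "?h q i \<in> ?S q'"
        by blast
      then obtain j where j: "j < 5" "?h q i = ?h q' j"
        by auto
      with that have "i = j"
        by (metis mod_mult_self4 mod_less atLeastLessThan_iff)
      with j show ?thesis
        by simp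
    qed
    with q q' show "q = q'"
      by (rule PiE_ext)
  qed
  moreover have "?S ` ?Q \<subseteq> C5_copies n (pentagon_blowup n)"
  proof (rule image_subsetI)
    fix q assume q: "q \<in> ?Q"
    have lt: "?h q i < n" if "i < 5" for i
    proof -
      \<comment> \<open>Strictness leaves room for the offset \<open>i\<close>, which is at most
        4.\<close>
      have "q i < n div 5"
        using q that by (auto simp: PiE_iff)
      with that show ?thesis
        by linarith
    qed
    have "induces_C5 (pentagon_blowup n) (?S q)"
      unfolding induces_C5_def
      by (rule exI[of _ "?h q"])
         (use inj lt in \<open>auto simp: bij_betw_def in_pentagon_blowup_iff\<close>)
    then show "?S q \<in> C5_copies n (pentagon_blowup n)"
      using lt card_image[OF inj] by (auto simp: C5_copies_def)
  qed
  moreover have "finite (C5_copies n (pentagon_blowup n))"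
    by (rule finite_subset[of _ "Pow {0..<n}"]) (auto simp: C5_copies_def)
  ultimately have "card ?Q \<le> card (C5_copies n (pentagon_blowup n))"
    by (rule card_inj_on_le)
  then show ?thesis
    by (simp add: card_PiE)
qed

section \<open>The limit\<close>

lemma ex_C5_K3_bounds:
  "(n div 5) ^ 5 \<le> ex_C5_K3 n" "3125 * ex_C5_K3 n \<le> n ^ 5"
proof -
  let ?A = "{card (C5_copies n E) | E. E \<in> graphs_on n \<and> triangle_free E}"
  have "finite (graphs_on n)"
    by (simp add: graphs_on_def)
  then have fin: "finite ?A"
    by simp
  have mem: "card (C5_copies n (pentagon_blowup n)) \<in> ?A"
    using pentagon_blowup_in_graphs_on triangle_free_pentagon_blowup by blast
  show "(n div 5) ^ 5 \<le> ex_C5_K3 n"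
    unfolding ex_C5_K3_def
    using card_C5_copies_pentagon_blowup_ge Max_ge[OF fin mem] by (rule order_trans)
  have "ex_C5_K3 n \<in> ?A"
    unfolding ex_C5_K3_def using fin mem by (intro Max_in) auto
  then show "3125 * ex_C5_K3 n \<le> n ^ 5"
    using card_C5_copies_le by auto
qed

lemma real_choose_5:
  "real (n choose 5) = real n * (real n - 1) * (real n - 2) * (real n - 3) * (real n - 4) / 120"
  by (simp add: binomial_gbinomial gbinomial_prod_rev eval_nat_numeral fact_numeral)

text \<open>Both bounds on \<open>ex_C5_K3 n\<close> are asymptotic to n^5/3125, while
  \<open>n choose 5\<close> is asymptotic to n^5/120; the ratio is 120/3125 = 24/625.\<close>

lemma ex_C5_K3_density_tendsto:
  "(\<lambda>n. real (ex_C5_K3 n) / real (n choose 5)) \<longlonglongrightarrow> 24 / 625"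
proof (rule tendsto_sandwich)
  have "((real n - 4) / 5) ^ 5 \<le> real (ex_C5_K3 n)" if "n \<ge> 4" for n
  proof -
    have "(real n - 4) / 5 \<le> real (n div 5)"
      proof -
      have "n \<le> 5 * (n div 5) + 4"
        by presburger
      then have "real n \<le> real (5 * (n div 5) + 4)"
        by (simp only: of_nat_le_iff)
      then show ?thesis
        by simp
    qed
    \<comment> \<open>Monotonicity of the power needs a nonnegative base, hence n at least
      4.\<close>
    then have "((real n - 4) / 5) ^ 5 \<le> real (n div 5) ^ 5"
      using that by (intro power_mono) auto
    also have "\<dots> \<le> real (ex_C5_K3 n)"
      using ex_C5_K3_bounds(1)[of n] by (metis of_nat_le_iff of_nat_power)
    finally show ?thesis .
  qed
  then show "\<forall>\<^sub>F n in sequentially.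
      ((real n - 4) / 5) ^ 5 / real (n choose 5) \<le> real (ex_C5_K3 n) / real (n choose 5)"
    by (intro eventually_sequentiallyI[of 4] divide_right_mono) auto
  have "real (ex_C5_K3 n) \<le> (real n / 5) ^ 5" for n
  proof -
    have "real (3125 * ex_C5_K3 n) \<le> real (n ^ 5)"
      using ex_C5_K3_bounds(2)[of n] by (simp only: of_nat_le_iff)
    then show ?thesis
      by (simp add: power_divide)
  qed
  then show "\<forall>\<^sub>F n in sequentially.
      real (ex_C5_K3 n) / real (n choose 5) \<le> (real n / 5) ^ 5 / real (n choose 5)"
    by (intro always_eventually allI divide_right_mono) auto
  show "(\<lambda>n. ((real n - 4) / 5) ^ 5 / real (n choose 5)) \<longlonglongrightarrow> 24 / 625"
    unfolding real_choose_5 power_divide by real_asymp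
  show "(\<lambda>n. (real n / 5) ^ 5 / real (n choose 5)) \<longlonglongrightarrow> 24 / 625"
    unfolding real_choose_5 power_divide by real_asymp
qed

theorem theorem1:
  shows "\<exists>L. (\<lambda>n. real (ex_C5_K3 n) / real (n choose 5)) \<longlonglongrightarrow> L \<and> L \<le> 24 / 625"
  using ex_C5_K3_density_tendsto by blast

end
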